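(* Let $E=\{E_1,\dots,E_m\}$ be the edge set of a bar framework on $n$ vertices in $\mathbb{R}^d$, let $k\in\{1,\dots,m\}$, and let lengths $l_i$ ($i\ne k$) be given. Suppose $p^*\in\mathbb{R}^{nd}$ is a strict local solution up to rigid body motions for one of $P_k^{+}$, $P_k^-$ which is certified by the second-order sufficient conditions: the KKT conditions hold at $p^*$ for some Lagrange multiplier $\lambda^*\in\mathbb{R}^m$ (with $\lambda^*_k=1$), and for every $v\in C_k(p^* )$ with $v\neq 0$, $$v^T\Big(\sum_{i=1}^m\lambda_i^*\nabla^2 f_i(p^* )\Big)v>0\ \text{ in the case of } P_k^+,\qquad v^T\Big(\sum_{i=1}^m\lambda_i^*\nabla^2 f_i(p^* )\Big)v<0\ \text{ in the case of } P_k^-.$$ Then the framework $(p^*,E)$ is prestress stable. If additionally $E$ is isostatic or under-constrained, then $(p^*,E)$ is not first-order rigid.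
   Context: A bar framework $(p,E)$ in $\mathbb{R}^d$ consists of vertex positions $p=(p_1,\dots,p_n)\in\mathbb{R}^{nd}$, $p_i\in\mathbb{R}^d$, and edges $E=\{E_1,\dots,E_m\}$, each joining two distinct vertices; the endpoints of $E_i$ are denoted $p_{i,1},p_{i,2}$. Set $f_i(p)=|p_{i,1}-p_{i,2}|^2$. The rigidity matrix $R(p)\in\mathbb{R}^{m\times nd}$ has $i$th row $\nabla f_i(p)$ (and $R(v)$ denotes the same matrix evaluated at $v\in\mathbb{R}^{nd}$). Two configurations are congruent if they differ by an isometry of $\mathbb{R}^d$ applied to all vertices. The space of trivial flexes is $\mathcal{T}(p)=\{v\in\mathbb{R}^{nd}: v_i=Ap_i+b,\ A\in\mathbb{R}^{d\times d}\text{ skew-symmetric},\ b\in\mathbb{R}^d\}$. A framework $(p,E)$ is first-order rigid if there is no $v$ with $R(p)v=0$ and $v\notin\mathcal{T}(p)$. It is prestress stable if there exists $\omega\in\mathbb{R}^m$ with $R(p)^T\omega=0$ such that $\omega^TR(v)v>0$ for all nonzero $v\in\mathrm{null}\,R(p)\cap\mathcal{T}(p)^\perp$. The edge set is isostatic if $m+\frac{d(d+1)}{2}=nd$ and under-constrained if $m+\frac{d(d+1)}{2}<nd$. Problem $P_k^{\pm}$ is: $\min_{p\in\mathbb{R}^{nd}} \pm f_k(p)$ subject to $f_i(p)=l_i^2$ for $i=1,\dots,m$, $i\ne k$ ($P_k^+$ minimizes $f_k$, $P_k^-$ maximizes $f_k$). A point is feasible if it satisfies the constraints. A point $p^*$ is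 a strict local solution of $P_k^+$ (resp. $P_k^-$) up to rigid body motions if it is feasible and there is a neighborhood $U$ of $p^*$ such that every feasible $q\in U$ not congruent to $p^*$ has $f_k(q)>f_k(p^* )$ (resp. $f_k(q)<f_k(p^* )$). The KKT conditions hold at $p$ with Lagrange multiplier $\lambda\in\mathbb{R}^m$ if $p$ is feasible, $\lambda_k=1$ and $\sum_{i=1}^m\lambda_i\nabla f_i(p)=0$. The critical cone up to rigid body motions is $C_k(p^* )=\{v\in\mathcal{T}(p^* )^\perp:\nabla f_i(p^* )v=0\ \text{for all } i\neq k\}$. *)

theory Defs
  imports "HOL-Analysis.Analysis"
begin

text \<open>
  A configuration of \<open>n = CARD('n)\<close> vertices in \<open>d\<close>-space, \<open>d = CARD('d)\<close>, is a vector with \<open>nd\<close> real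
  coordinates indexed by pairs (vertex, coordinate), so that the rigidity matrix and the Hessians
  are honest real matrices. The index type \<open>'m\<close> enumerates the edges, \<open>m = CARD('m)\<close>.
\<close>

type_synonym ('n, 'd) config = "real ^ ('n \<times> 'd)"

definition pos :: "('n::finite, 'd::finite) config \<Rightarrow> 'n \<Rightarrow> real ^ 'd"
  where "pos p v = (\<chi> a. p $ (v, a))"

text \<open>
  The edges form a set, so distinct indices give distinct unordered pairs; the order of the two
  endpoints in \<open>E i\<close> is only a labelling.
\<close>

definition edge_set :: "('m::finite \<Rightarrow> 'n::finite \<times> 'n) \<Rightarrow> bool"
  where "edge_set E \<longleftrightarrow>
    (\<forall>i. fst (E i) \<noteq> snd (E i)) \<and> inj (\<lambda>i. {fst (E i), snd (E i)})"

definition sq_length ::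
    "('m::finite \<Rightarrow> 'n::finite \<times> 'n) \<Rightarrow> 'm \<Rightarrow> ('n, 'd::finite) config \<Rightarrow> real"
  where "sq_length E i p = (norm (pos p (fst (E i)) - pos p (snd (E i))))\<^sup>2"

definition gradient :: "('a::real_inner \<Rightarrow> real) \<Rightarrow> 'a \<Rightarrow> 'a"
  where "gradient f x = (THE D. GDERIV f x :> D)"

definition hessian :: "(real ^ 'a::finite \<Rightarrow> real) \<Rightarrow> real ^ 'a \<Rightarrow> real ^ 'a ^ 'a"
  where "hessian f x = jacobian (gradient f) (at x)"

definition rigidity_matrix ::
    "('m::finite \<Rightarrow> 'n::finite \<times> 'n) \<Rightarrow> ('n, 'd::finite) config \<Rightarrow> real ^ ('n \<times> 'd) ^ 'm"
  where "rigidity_matrix E p = (\<chi> i. gradient (sq_length E i) p)"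

definition congruent_config ::
    "('n::finite, 'd::finite) config \<Rightarrow> ('n, 'd) config \<Rightarrow> bool"
  where "congruent_config p q \<longleftrightarrow>
    (\<exists>g. (\<forall>x y. dist (g x) (g y) = dist x y) \<and> (\<forall>v. pos q v = g (pos p v)))"

definition trivial_flexes :: "('n::finite, 'd::finite) config \<Rightarrow> ('n, 'd) config set"
  where "trivial_flexes p =
    {u. \<exists>(A :: real ^ 'd ^ 'd) b. transpose A = - A \<and> (\<forall>v. pos u v = A *v pos p v + b)}"

definition first_order_rigid ::
    "('m::finite \<Rightarrow> 'n::finite \<times> 'n) \<Rightarrow> ('n, 'd::finite) config \<Rightarrow> bool"
  where "first_order_rigid E p \<longleftrightarrow>
    \<not> (\<exists>v. rigidity_matrix E p *v v = 0 \<and> v \<notin> trivial_flexes p)"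

definition prestress_stable ::
    "('m::finite \<Rightarrow> 'n::finite \<times> 'n) \<Rightarrow> ('n, 'd::finite) config \<Rightarrow> bool"
  where "prestress_stable E p \<longleftrightarrow>
    (\<exists>\<omega> :: real ^ 'm. transpose (rigidity_matrix E p) *v \<omega> = 0 \<and>
      (\<forall>v. rigidity_matrix E p *v v = 0 \<and> v \<in> (trivial_flexes p)\<^sup>\<bottom> \<and> v \<noteq> 0 \<longrightarrow>
        \<omega> \<bullet> (rigidity_matrix E v *v v) > 0))"

text \<open>In the following two counts the division is exact, as \<open>d (d + 1)\<close> is even.\<close>

definition isostatic ::
    "'d::finite itself \<Rightarrow> ('m::finite \<Rightarrow> 'n::finite \<times> 'n) \<Rightarrow> bool"
  where "isostatic _ E \<longleftrightarrow>
    CARD('m) + CARD('d) * (CARD('d) + 1) div 2 = CARD('n) * CARD('d)"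

definition under_constrained ::
    "'d::finite itself \<Rightarrow> ('m::finite \<Rightarrow> 'n::finite \<times> 'n) \<Rightarrow> bool"
  where "under_constrained _ E \<longleftrightarrow>
    CARD('m) + CARD('d) * (CARD('d) + 1) div 2 < CARD('n) * CARD('d)"

text \<open>The value \<open>l k\<close> is never used below.\<close>

definition feasible ::
    "('m::finite \<Rightarrow> 'n::finite \<times> 'n) \<Rightarrow> ('m \<Rightarrow> real) \<Rightarrow> 'm \<Rightarrow> ('n, 'd::finite) config \<Rightarrow> bool"
  where "feasible E l k p \<longleftrightarrow> (\<forall>i. i \<noteq> k \<longrightarrow> sq_length E i p = (l i)\<^sup>2)"

definition strict_local_solution_plus ::
    "('m::finite \<Rightarrow> 'n::finite \<times> 'n) \<Rightarrow> ('m \<Rightarrow> real) \<Rightarrow> 'm \<Rightarrow> ('n, 'd::finite) config \<Rightarrow> bool"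
  where "strict_local_solution_plus E l k p \<longleftrightarrow> feasible E l k p \<and>
    (\<exists>U. open U \<and> p \<in> U \<and>
      (\<forall>q\<in>U. feasible E l k q \<and> \<not> congruent_config p q \<longrightarrow> sq_length E k q > sq_length E k p))"

definition strict_local_solution_minus ::
    "('m::finite \<Rightarrow> 'n::finite \<times> 'n) \<Rightarrow> ('m \<Rightarrow> real) \<Rightarrow> 'm \<Rightarrow> ('n, 'd::finite) config \<Rightarrow> bool"
  where "strict_local_solution_minus E l k p \<longleftrightarrow> feasible E l k p \<and>
    (\<exists>U. open U \<and> p \<in> U \<and>
      (\<forall>q\<in>U. feasible E l k q \<and> \<not> congruent_config p q \<longrightarrow> sq_length E k q < sq_length E k p))"

definition kkt ::
    "('m::finite \<Rightarrow> 'n::finite \<times> 'n) \<Rightarrow> ('m \<Rightarrow> real) \<Rightarrow> 'm \<Rightarrow> ('n, 'd::finite) config \<Rightarrow> real ^ 'm \<Rightarrow> bool"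
  where "kkt E l k p \<mu> \<longleftrightarrow> feasible E l k p \<and> \<mu> $ k = 1 \<and>
    (\<Sum>i\<in>UNIV. (\<mu> $ i) *\<^sub>R gradient (sq_length E i) p) = 0"

definition critical_cone ::
    "('m::finite \<Rightarrow> 'n::finite \<times> 'n) \<Rightarrow> 'm \<Rightarrow> ('n, 'd::finite) config \<Rightarrow> ('n, 'd) config set"
  where "critical_cone E k p =
    {v \<in> (trivial_flexes p)\<^sup>\<bottom>. \<forall>i. i \<noteq> k \<longrightarrow> gradient (sq_length E i) p \<bullet> v = 0}"

definition lagrangian_hessian ::
    "('m::finite \<Rightarrow> 'n::finite \<times> 'n) \<Rightarrow> ('n, 'd::finite) config \<Rightarrow> real ^ 'm \<Rightarrow>
      real ^ ('n \<times> 'd) ^ ('n \<times> 'd)"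
  where "lagrangian_hessian E p \<mu> = (\<Sum>i\<in>UNIV. (\<mu> $ i) *\<^sub>R hessian (sq_length E i) p)"

definition second_order_sufficient_plus ::
    "('m::finite \<Rightarrow> 'n::finite \<times> 'n) \<Rightarrow> ('m \<Rightarrow> real) \<Rightarrow> 'm \<Rightarrow> ('n, 'd::finite) config \<Rightarrow> bool"
  where "second_order_sufficient_plus E l k p \<longleftrightarrow>
    (\<exists>\<mu>. kkt E l k p \<mu> \<and>
      (\<forall>v \<in> critical_cone E k p. v \<noteq> 0 \<longrightarrow> v \<bullet> (lagrangian_hessian E p \<mu> *v v) > 0))"

definition second_order_sufficient_minus ::
    "('m::finite \<Rightarrow> 'n::finite \<times> 'n) \<Rightarrow> ('m \<Rightarrow> real) \<Rightarrow> 'm \<Rightarrow> ('n, 'd::finite) config \<Rightarrow> bool"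
  where "second_order_sufficient_minus E l k p \<longleftrightarrow>
    (\<exists>\<mu>. kkt E l k p \<mu> \<and>
      (\<forall>v \<in> critical_cone E k p. v \<noteq> 0 \<longrightarrow> v \<bullet> (lagrangian_hessian E p \<mu> *v v) < 0))"

end

theory Submission
  imports Defs
begin

text \<open>
  Each squared edge length is a quadratic form in the configuration, so its gradient
  \<open>\<nabla>f\<^sub>i(p)\<close> is linear in \<open>p\<close> and its Hessian applied to \<open>v\<close> is \<open>\<nabla>f\<^sub>i(v)\<close>
  (lemma \<open>hessian_sq_length\<close>). The second-order form of the Lagrangian
  \<open>v\<^sup>T (\<Sum>\<^sub>i \<mu>\<^sub>i \<nabla>\<^sup>2f\<^sub>i(p)) v\<close> is therefore \<open>\<mu>\<^sup>T R(v) v\<close>, the form in the definition of prestress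
  stability, and the KKT equation \<open>\<Sum>\<^sub>i \<mu>\<^sub>i \<nabla>f\<^sub>i(p) = 0\<close> says that \<open>\<mu>\<close> is an equilibrium stress.
  As \<open>null R(p) \<inter> \<T>(p)\<^sup>\<bottom>\<close> is contained in the critical cone, which imposes all the equations
  except the \<open>k\<close>th, the stress \<open>\<mu>\<close> certifies prestress stability for the minimization problem,
  and \<open>-\<mu>\<close> does for the maximization problem.

  For the second claim, \<open>\<mu>\<^sub>k = 1\<close> makes \<open>\<mu>\<close> a nonzero linear dependency among the \<open>m\<close> rows of
  \<open>R(p)\<close>, so the null space of \<open>R(p)\<close> has dimension at least \<open>nd - m + 1\<close>
  (lemma \<open>dim_nullspace_row_dependency\<close>). The trivial flexes have dimension at most \<open>d(d+1)/2\<close>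
  (lemma \<open>dim_trivial_flexes_le\<close>), which is at most \<open>nd - m\<close> when \<open>E\<close> is isostatic or
  under-constrained. Hence some element of the null space is not a trivial flex.
\<close>

section \<open>Gradients and Hessians of squared edge lengths\<close>

lemma gradient_eqI:
  assumes "GDERIV f x :> D"
  shows "gradient f x = D"
  unfolding gradient_def
proof (rule the_equality)
  show "GDERIV f x :> D" by fact
  fix D' assume "GDERIV f x :> D'"
  then have "(\<lambda>h. h \<bullet> D') = (\<lambda>h. h \<bullet> D)"
    using assms unfolding gderiv_def by (rule has_derivative_unique)
  then have "h \<bullet> (D' - D) = 0" for h
    by (metis inner_diff_right right_minus_eq)
  then show "D' = D"
    by (metis inner_eq_zero_iff right_minus_eq)
qed

definition edge_vector ::
    "('m::finite \<Rightarrow> 'n::finite \<times> 'n) \<Rightarrow> 'm \<Rightarrow> ('n, 'd::finite) config \<Rightarrow> real ^ 'd"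
  where "edge_vector E i p = pos p (fst (E i)) - pos p (snd (E i))"

lemma linear_edge_vector: "linear (edge_vector E i)"
  by (rule linearI) (simp_all add: edge_vector_def pos_def vec_eq_iff algebra_simps)

text \<open>
  With \<open>D\<close> the linear map taking a configuration to its \<open>i\<close>th edge vector, \<open>f\<^sub>i(p) = \<bar>D p\<bar>\<^sup>2\<close> has
  gradient \<open>2 D\<^sup>* D p\<close>. The adjoint keeps coordinates out of the computation.
\<close>

lemma gradient_sq_length:
  fixes p :: "('n::finite, 'd::finite) config"
  shows "gradient (sq_length E i) p = 2 *\<^sub>R adjoint (edge_vector E i) (edge_vector E i p)"
proof (rule gradient_eqI)
  have "((\<lambda>q. edge_vector E i q \<bullet> edge_vector E i q) has_derivative
      (\<lambda>h. edge_vector E i p \<bullet> edge_vector E i h + edge_vector E i h \<bullet> edge_vector E i p)) (at p)"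
    by (intro has_derivative_inner linear_imp_has_derivative linear_edge_vector)
  moreover have "sq_length E i = (\<lambda>q :: ('n, 'd) config. edge_vector E i q \<bullet> edge_vector E i q)"
    by (simp add: fun_eq_iff sq_length_def edge_vector_def power2_norm_eq_inner)
  moreover have "(\<lambda>h. edge_vector E i p \<bullet> edge_vector E i h + edge_vector E i h \<bullet> edge_vector E i p) =
      (\<lambda>h. h \<bullet> 2 *\<^sub>R adjoint (edge_vector E i) (edge_vector E i p))"
    by (simp add: fun_eq_iff adjoint_works[OF linear_edge_vector] inner_commute)
  ultimately show "GDERIV (sq_length E i) p :> 2 *\<^sub>R adjoint (edge_vector E i) (edge_vector E i p)"
    by (simp only: gderiv_def)
qed

lemma linear_gradient_sq_length: "linear (gradient (sq_length E i))"
proof -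
  have "linear (adjoint (edge_vector E i) \<circ> edge_vector E i)"
    by (intro linear_compose adjoint_linear linear_edge_vector)
  then show ?thesis
    using linear_compose_scale_right[of _ 2] by (auto simp: gradient_sq_length[abs_def] o_def)
qed

text \<open>A linear map is its own derivative, so the Hessian is the matrix of the gradient map.\<close>

lemma hessian_sq_length:
  "hessian (sq_length E i) p *v v = gradient (sq_length E i) v"
proof -
  have "frechet_derivative (gradient (sq_length E i)) (at p) = gradient (sq_length E i)"
    using frechet_derivative_at linear_imp_has_derivative[OF linear_gradient_sq_length] by metis
  then show ?thesis
    using matrix_vector_mul(2)[OF linear_gradient_sq_length] by (metis hessian_def jacobian_def)
qed

section \<open>The Lagrangian and equilibrium stresses\<close>

lemma rigidity_matrix_mult_component:
  "(rigidity_matrix E p *v v) $ i = gradient (sq_length E i) p \<bullet> v"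
  by (simp add: matrix_vector_mul_component rigidity_matrix_def)

lemma transpose_rigidity_matrix_mult:
  "transpose (rigidity_matrix E p) *v \<omega> = (\<Sum>i\<in>UNIV. (\<omega> $ i) *\<^sub>R gradient (sq_length E i) p)"
  by (simp add: vec_eq_iff vector_matrix_mult_def rigidity_matrix_def mult.commute)

lemma matrix_vector_mult_sum_left:
  fixes M :: "'i \<Rightarrow> real ^ 'a ^ 'b"
  shows "(\<Sum>i\<in>S. M i) *v x = (\<Sum>i\<in>S. M i *v x)"
  by (induction S rule: infinite_finite_induct) (simp_all add: matrix_vector_mult_add_rdistrib)

lemma lagrangian_hessian_form:
  "v \<bullet> (lagrangian_hessian E p \<mu> *v v) = \<mu> \<bullet> (rigidity_matrix E v *v v)"
proof -
  have "v \<bullet> (lagrangian_hessian E p \<mu> *v v) =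
      (\<Sum>i\<in>UNIV. \<mu> $ i * (v \<bullet> (hessian (sq_length E i) p *v v)))"
    unfolding lagrangian_hessian_def
    by (simp add: matrix_vector_mult_sum_left inner_sum_right flip: scaleR_matrix_vector_assoc)
  then show ?thesis
    by (simp add: hessian_sq_length inner_vec_def[of \<mu>] rigidity_matrix_mult_component inner_commute)
qed

lemma nullspace_subset_critical_cone:
  assumes "rigidity_matrix E p *v v = 0" "v \<in> (trivial_flexes p)\<^sup>\<bottom>"
  shows "v \<in> critical_cone E k p"
  using assms by (auto simp: critical_cone_def simp flip: rigidity_matrix_mult_component)

text \<open>
  Minimization is the case \<open>s = 1\<close> and maximization the case \<open>s = -1\<close>. The stress \<open>s \<mu>\<close> is the
  certificate, since the equilibrium equation does not see the sign while the second-order form does.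
\<close>

lemma prestress_stable_if_signed_second_order:
  assumes "kkt E l k p \<mu>"
    and "\<And>v. v \<in> critical_cone E k p \<Longrightarrow> v \<noteq> 0 \<Longrightarrow> s * (v \<bullet> (lagrangian_hessian E p \<mu> *v v)) > 0"
  shows "prestress_stable E p"
  unfolding prestress_stable_def
proof (intro exI[of _ "s *\<^sub>R \<mu>"] conjI allI impI)
  have "transpose (rigidity_matrix E p) *v \<mu> = 0"
    using assms(1) unfolding kkt_def transpose_rigidity_matrix_mult by blast
  then show "transpose (rigidity_matrix E p) *v (s *\<^sub>R \<mu>) = 0"
    by (simp only: matrix_vector_mult_scaleR scaleR_zero_right)
next
  fix v assume "rigidity_matrix E p *v v = 0 \<and> v \<in> (trivial_flexes p)\<^sup>\<bottom> \<and> v \<noteq> 0"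
  then show "(s *\<^sub>R \<mu>) \<bullet> (rigidity_matrix E v *v v) > 0"
    using assms(2)[of v] nullspace_subset_critical_cone[of E p v k]
    by (simp add: lagrangian_hessian_form)
qed

section \<open>Counting dimensions\<close>

text \<open>
  Equal row and column rank turn a dependency among the rows into a rank drop, and the null space
  is the orthogonal complement of the row space.
\<close>

lemma dim_nullspace_row_dependency:
  fixes A :: "real ^ 'a ^ 'b"
  assumes "transpose A *v w = 0" "w \<noteq> 0"
  shows "CARD('a) < dim {x. A *v x = 0} + CARD('b)"
proof -
  have "\<not> inj ((*v) (transpose A))"
    using assms by (metis injD matrix_vector_mult_0_right)
  then have "rank A < CARD('b)"
    by (metis less_rank_noninjective rank_transpose)
  then have "dim (span (rows A)) < CARD('b)"
    by (simp add: row_rank_def)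
  moreover have "dim {y \<in> UNIV. \<forall>x \<in> span (rows A). orthogonal x y} + dim (span (rows A)) =
      dim (UNIV :: (real ^ 'a) set)"
    by (rule dim_subspace_orthogonal_to_vectors) auto
  moreover have "{y \<in> UNIV. \<forall>x \<in> span (rows A). orthogonal x y} \<subseteq> {x. A *v x = 0}"
  proof clarsimp
    fix y assume y: "\<forall>x \<in> span (rows A). orthogonal x y"
    show "A *v y = 0"
    proof (rule vec_eq_iff[THEN iffD2], rule allI)
      fix i
      have "row i A \<in> span (rows A)"
        by (auto simp: rows_def intro: span_base)
      then have "row i A \<bullet> y = 0"
        using y by (simp add: orthogonal_def)
      then show "(A *v y) $ i = 0 $ i"
        by (simp add: matrix_vector_mul_component row_def)
    qed
  qed
  ultimately show ?thesis
    using dim_subset[of "{y \<in> UNIV. \<forall>x \<in> span (rows A). orthogonal x y}" "{x. A *v x = 0}"]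
    by simp
qed

definition translation_field :: "'d \<Rightarrow> ('n::finite, 'd::finite) config"
  where "translation_field a = (\<chi> x. if snd x = a then 1 else 0)"

definition rotation_field :: "('n, 'd) config \<Rightarrow> 'd \<Rightarrow> 'd \<Rightarrow> ('n::finite, 'd::finite) config"
  where "rotation_field p a b =
    (\<chi> x. (if snd x = a then p $ (fst x, b) else 0) - (if snd x = b then p $ (fst x, a) else 0))"

text \<open>
  Antisymmetrizing the sum for \<open>A p\<^sub>v = \<Sum>\<^sub>a\<^sub>b A\<^sub>a\<^sub>b (p\<^sub>v)\<^sub>b e\<^sub>a\<close> over \<open>(a, b) \<leftrightarrow> (b, a)\<close> gives the
  factor \<open>1/2\<close>.
\<close>

lemma trivial_flex_decomposition:
  fixes p u :: "('n::finite, 'd::finite) config"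
  assumes skew: "transpose A = - A" and u: "\<And>v. pos u v = A *v pos p v + b"
  shows "u = (\<Sum>a\<in>UNIV. (b $ a) *\<^sub>R translation_field a) +
             (\<Sum>a\<in>UNIV. \<Sum>a'\<in>UNIV. (A $ a $ a' / 2) *\<^sub>R rotation_field p a a')"
proof (rule vec_eq_iff[THEN iffD2], safe)
  fix v :: 'n and c :: 'd
  have anti: "A $ a $ a' = - A $ a' $ a" for a a'
  proof -
    have "transpose A $ a' $ a = (- A) $ a' $ a"
      by (simp only: skew)
    then show ?thesis
      by (simp add: transpose_def)
  qed
  have "(\<Sum>a\<in>UNIV. \<Sum>a'\<in>UNIV. A $ a $ a' / 2 *
          ((if c = a then p $ (v, a') else 0) - (if c = a' then p $ (v, a) else 0)))
      = (\<Sum>a\<in>UNIV. \<Sum>a'\<in>UNIV. if c = a then A $ c $ a' / 2 * p $ (v, a') else 0) -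
        (\<Sum>a\<in>UNIV. \<Sum>a'\<in>UNIV. if c = a' then A $ a $ c / 2 * p $ (v, a) else 0)"
    unfolding sum_subtractf[symmetric] by (intro sum.cong refl) (auto simp: algebra_simps)
  also have "(\<Sum>a\<in>UNIV. \<Sum>a'\<in>UNIV. if c = a then A $ c $ a' / 2 * p $ (v, a') else 0) =
      (\<Sum>a'\<in>UNIV. A $ c $ a' / 2 * p $ (v, a'))"
    by (subst sum.swap) simp
  also have "(\<Sum>a\<in>UNIV. \<Sum>a'\<in>UNIV. if c = a' then A $ a $ c / 2 * p $ (v, a) else 0) =
      (\<Sum>a\<in>UNIV. A $ a $ c / 2 * p $ (v, a))"
    by simp
  also have "\<dots> = - (\<Sum>a\<in>UNIV. A $ c $ a / 2 * p $ (v, a))"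
    unfolding sum_negf[symmetric] by (intro sum.cong refl) (subst anti, simp)
  finally have rot: "(\<Sum>a\<in>UNIV. \<Sum>a'\<in>UNIV. A $ a $ a' / 2 *
          ((if c = a then p $ (v, a') else 0) - (if c = a' then p $ (v, a) else 0)))
      = (\<Sum>a\<in>UNIV. A $ c $ a * p $ (v, a))"
    by (simp flip: sum.distrib)
  have "u $ (v, c) = pos u v $ c"
    by (simp add: pos_def)
  also have "\<dots> = (A *v pos p v + b) $ c"
    by (simp only: u)
  also have "\<dots> = (\<Sum>a\<in>UNIV. A $ c $ a * p $ (v, a)) + b $ c"
    by (simp add: matrix_vector_mult_def pos_def)
  finally show "u $ (v, c) = ((\<Sum>a\<in>UNIV. (b $ a) *\<^sub>R translation_field a) +
      (\<Sum>a\<in>UNIV. \<Sum>a'\<in>UNIV. (A $ a $ a' / 2) *\<^sub>R rotation_field p a a')) $ (v, c)"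
    using rot by (simp add: translation_field_def rotation_field_def if_distrib cong: if_cong)
qed

text \<open>
  Unordered pairs of coordinates, counted as the pairs weakly increasing along an enumeration:
  they and their mirror images cover the square and overlap in the diagonal.
\<close>

lemma card_ordered_pairs:
  fixes f :: "'d::finite \<Rightarrow> nat"
  assumes "inj f"
  shows "card {(a, b). f a \<le> f b} = CARD('d) * (CARD('d) + 1) div 2"
proof -
  let ?I = "{(a, b). f a \<le> f b}" and ?J = "{(a, b). f b \<le> f a}"
  have "?J = prod.swap ` ?I"
    by force
  then have "card ?J = card ?I"
    by (simp add: card_image)
  moreover have "?I \<union> ?J = UNIV"
    by auto
  moreover have "?I \<inter> ?J = (\<lambda>a. (a, a)) ` UNIV"
    using assms by (auto simp: inj_eq)
  moreover have "card ((\<lambda>a. (a, a)) ` (UNIV :: 'd set)) = CARD('d)"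
    by (rule card_image) (simp add: inj_on_def)
  moreover have "card ?I + card ?J = card (?I \<union> ?J) + card (?I \<inter> ?J)"
    by (rule card_Un_Int) auto
  ultimately have "2 * card ?I = CARD('d) * (CARD('d) + 1)"
    by simp
  then show ?thesis
    by simp
qed

text \<open>
  A spanning family indexed by the weakly increasing pairs: the diagonal pairs carry the
  translations, the others the rotations in coordinate planes.
\<close>

lemma dim_trivial_flexes_le:
  fixes p :: "('n::finite, 'd::finite) config"
  shows "dim (trivial_flexes p) \<le> CARD('d) * (CARD('d) + 1) div 2"
proof -
  obtain f :: "'d \<Rightarrow> nat" where f: "inj f"
    using finite_imp_inj_to_nat_seg[of "UNIV :: 'd set"] by auto
  define I where "I = {(a, b). f a \<le> f b}"
  define g where "g = (\<lambda>(a, b). if a = b then translation_field a else rotation_field p a b)"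
  have trans: "translation_field a \<in> span (g ` I)" for a
    by (rule span_base, rule image_eqI[of _ _ "(a, a)"]) (auto simp: g_def I_def)
  have swap: "rotation_field p a b = - rotation_field p b a" for a b
    by (simp add: rotation_field_def vec_eq_iff)
  have increasing: "rotation_field p a b \<in> span (g ` I)" if "f a < f b" for a b
    by (rule span_base, rule image_eqI[of _ _ "(a, b)"]) (use that in \<open>auto simp: g_def I_def\<close>)
  have rot: "rotation_field p a b \<in> span (g ` I)" for a b
  proof (cases "f a" "f b" rule: linorder_cases)
    case less
    then show ?thesis by (rule increasing)
  next
    case equal
    then have "a = b"
      using f by (simp add: injD)
    then have "rotation_field p a b = 0"
      by (simp add: rotation_field_def vec_eq_iff)
    then show ?thesis by (simp add: span_zero)
  next
    case greater
    then show ?thesis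
      by (subst swap) (intro span_neg increasing)
  qed
  have "trivial_flexes p \<subseteq> span (g ` I)"
  proof
    fix u assume "u \<in> trivial_flexes p"
    then obtain A b where "transpose A = - A" "\<And>v. pos u v = A *v pos p v + b"
      by (auto simp: trivial_flexes_def)
    from trivial_flex_decomposition[OF this] show "u \<in> span (g ` I)"
      by (metis (no_types, lifting) span_add span_scale span_sum trans rot)
  qed
  then have "dim (trivial_flexes p) \<le> card (g ` I)"
    by (rule dim_le_card) simp
  also have "\<dots> \<le> card I"
    by (rule card_image_le) simp
  also have "\<dots> = CARD('d) * (CARD('d) + 1) div 2"
    unfolding I_def using f by (rule card_ordered_pairs)
  finally show ?thesis .
qed

lemma not_first_order_rigid_if_stressed:
  fixes E :: "'m::finite \<Rightarrow> 'n::finite \<times> 'n" and p :: "('n, 'd::finite) config"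
  assumes "transpose (rigidity_matrix E p) *v \<omega> = 0" "\<omega> \<noteq> 0"
    and "isostatic TYPE('d) E \<or> under_constrained TYPE('d) E"
  shows "\<not> first_order_rigid E p"
proof
  assume "first_order_rigid E p"
  then have "{v. rigidity_matrix E p *v v = 0} \<subseteq> trivial_flexes p"
    by (auto simp: first_order_rigid_def)
  then have "dim {v. rigidity_matrix E p *v v = 0} \<le> CARD('d) * (CARD('d) + 1) div 2"
    using dim_trivial_flexes_le[of p] dim_subset order_trans by blast
  moreover have "CARD('n) * CARD('d) < dim {v. rigidity_matrix E p *v v = 0} + CARD('m)"
    using dim_nullspace_row_dependency[OF assms(1,2)] by simp
  ultimately show False
    using assms(3) unfolding isostatic_def under_constrained_def by linarith
qed

theorem theorem3p5:
  fixes E :: "'m::finite \<Rightarrow> 'n::finite \<times> 'n"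
    and k :: 'm
    and l :: "'m \<Rightarrow> real"
    and p :: "('n, 'd::finite) config"
  assumes "edge_set E"
    and "(strict_local_solution_plus E l k p \<and> second_order_sufficient_plus E l k p) \<or>
         (strict_local_solution_minus E l k p \<and> second_order_sufficient_minus E l k p)"
  shows "prestress_stable E p \<and>
         (isostatic TYPE('d) E \<or> under_constrained TYPE('d) E \<longrightarrow> \<not> first_order_rigid E p)"
proof -
  obtain \<mu> and s :: real where kkt: "kkt E l k p \<mu>"
    and pos: "\<And>v. v \<in> critical_cone E k p \<Longrightarrow> v \<noteq> 0 \<Longrightarrow>
      s * (v \<bullet> (lagrangian_hessian E p \<mu> *v v)) > 0"
  proof -
    from assms(2) consider "second_order_sufficient_plus E l k p"
      | "second_order_sufficient_minus E l k p"
      by blast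
    then show thesis
    proof cases
      case 1
      then show thesis
        using that[of _ 1] by (auto simp: second_order_sufficient_plus_def)
    next
      case 2
      then show thesis
        using that[of _ "-1"] by (auto simp: second_order_sufficient_minus_def)
    qed
  qed
  have "transpose (rigidity_matrix E p) *v \<mu> = 0" "\<mu> \<noteq> 0"
    using kkt unfolding kkt_def transpose_rigidity_matrix_mult by auto
  then show ?thesis
    using prestress_stable_if_signed_second_order[OF kkt pos]
      not_first_order_rigid_if_stressed by blast
qed

end
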